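(* Let $S$ be a regular semigroup with $|S|\ge 2$. Then $S$ is uniform if and only if $S$ has one of the following structures: (i) $S=G$ or $S=G^0$, where $G$ is a group; (ii) $S=G\sqcup\{\theta_1,\theta_2\}$ (disjoint union), where $G$ is a group (a subsemigroup of $S$) whose identity $1$ is the identity element of $S$, $\theta_1\neq\theta_2$ are left zero elements of $S$, and $g\theta_i=\theta_j$ for all $g\in G\setminus\{1\}$ and $1\le i\ne j\le 2$; (iii) $S=\{\theta_1,\theta_2\}$, where $\theta_1\ne\theta_2$ are left zero elements; (iv) $S=G$ or $S=G^0$, where $G$ is a right group. Here structures (i) and (ii) are those of the regular uniform semigroups with an identity element (monoids), and structures (iii) and (iv) are those of the regular uniform semigroups without an identity element; that is, if $S$ has an identity element then $S$ is uniform iff (i) or (ii) holds, and if $S$ has no identity element then $S$ is uniform iff (iii) or (iv) holds.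
   Context: A right $S$-act is a nonempty set $A$ with a map $A\times S\to A$, $(a,s)\mapsto as$, with $a(st)=(as)t$. A subact is a nonempty subset closed under the action; an $S$-homomorphism is a map $f$ with $f(as)=f(a)s$; a monomorphism is an injective $S$-homomorphism. An element $\theta$ of an act is a zero element if $\theta s=\theta$ for all $s\in S$; a subact is nonzero if it is not a one-element subact. A subact $B$ of $A$ is large in $A$ if every $S$-homomorphism $g:A\to C$ (for any right $S$-act $C$) whose restriction to $B$ is injective is itself injective. A right $S$-act is uniform if every nonzero subact is large in it. A semigroup $S$ is uniform (i.e. right uniform) if the right $S$-act $S_S$ ($S$ acting on itself by right multiplication; its subacts are the nonempty right ideals) is uniform. A left zero element of $S$ is $\theta$ with $\theta s=\theta$ for all $s\in S$. $S$ is regular if for every $s\in S$ there is $x\in S$ with $s=sxs$. A right group is a semigroup that is right simple (its only right ideal is itself) and left cancellative. For a (right) group $G$, $G^0=G\cup\{0\}$ is $G$ with a new zero element $0$ adjoined (also when $G$ is trivial). *)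

theory Defs
  imports "HOL-Algebra.Group"
begin

text \<open>
  A semigroup is a carrier set with an operation that matters only on that carrier; likewise
  for an act. Subsemigroups are given by subsets and the restricted operation.
\<close>

locale semigroup_on =
  fixes S :: "'a set" and mul :: "'a \<Rightarrow> 'a \<Rightarrow> 'a"
  assumes nonempty: "S \<noteq> {}"
    and mult_closed: "\<And>s t. s \<in> S \<Longrightarrow> t \<in> S \<Longrightarrow> mul s t \<in> S"
    and mult_assoc: "\<And>s t u. s \<in> S \<Longrightarrow> t \<in> S \<Longrightarrow> u \<in> S \<Longrightarrow> mul (mul s t) u = mul s (mul t u)"

definition right_act ::
  "'a set \<Rightarrow> ('a \<Rightarrow> 'a \<Rightarrow> 'a) \<Rightarrow> 'b set \<Rightarrow> ('b \<Rightarrow> 'a \<Rightarrow> 'b) \<Rightarrow> bool" where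
  "right_act S mul A act \<longleftrightarrow>
     A \<noteq> {} \<and>
     (\<forall>a\<in>A. \<forall>s\<in>S. act a s \<in> A) \<and>
     (\<forall>a\<in>A. \<forall>s\<in>S. \<forall>t\<in>S. act a (mul s t) = act (act a s) t)"

definition subact :: "'a set \<Rightarrow> 'b set \<Rightarrow> 'b set \<Rightarrow> ('b \<Rightarrow> 'a \<Rightarrow> 'b) \<Rightarrow> bool" where
  "subact S B A act \<longleftrightarrow> B \<noteq> {} \<and> B \<subseteq> A \<and> (\<forall>b\<in>B. \<forall>s\<in>S. act b s \<in> B)"

definition act_hom ::
  "'a set \<Rightarrow> 'b set \<Rightarrow> ('b \<Rightarrow> 'a \<Rightarrow> 'b) \<Rightarrow> 'c set \<Rightarrow> ('c \<Rightarrow> 'a \<Rightarrow> 'c) \<Rightarrow> ('b \<Rightarrow> 'c) \<Rightarrow> bool" where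
  "act_hom S A act C act' f \<longleftrightarrow>
     (\<forall>a\<in>A. f a \<in> C) \<and> (\<forall>a\<in>A. \<forall>s\<in>S. f (act a s) = act' (f a) s)"

text \<open>
  A definition in HOL cannot quantify over types, so the codomain \<open>C\<close> ranges here over the acts
  whose carrier lies in the type of the elements of \<open>A\<close>. Lemma \<open>large_subact_any_codomain\<close> below
  shows that nothing is lost: the property then holds for acts \<open>C\<close> over every type, because the
  image of a homomorphism can be copied into \<open>A\<close> along a choice of preimages.
\<close>

definition large_subact ::
  "'a set \<Rightarrow> ('a \<Rightarrow> 'a \<Rightarrow> 'a) \<Rightarrow> 'b set \<Rightarrow> 'b set \<Rightarrow> ('b \<Rightarrow> 'a \<Rightarrow> 'b) \<Rightarrow> bool" where
  "large_subact S mul B A act \<longleftrightarrow>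
     subact S B A act \<and>
     (\<forall>(C :: 'b set) act' g.
        right_act S mul C act' \<and> act_hom S A act C act' g \<and> inj_on g B \<longrightarrow> inj_on g A)"

lemma large_subact_any_codomain:
  fixes C :: "'c set" and A :: "'b set"
  assumes A: "right_act S mul A act"
    and large: "large_subact S mul B A act"
    and S: "semigroup_on S mul"
    and C: "right_act S mul C act'"
    and g: "act_hom S A act C act' g"
    and inj: "inj_on g B"
  shows "inj_on g A"
proof -
  define r where "r = inv_into A g"
  define g' where "g' a = r (g a)" for a
  define act'' where "act'' x s = r (g (act x s))" for x s
  have r: "r (g a) \<in> A" "g (r (g a)) = g a" if "a \<in> A" for a
    using that by (auto simp: r_def inv_into_into f_inv_into_f)
  have cl: "act a s \<in> A" if "a \<in> A" "s \<in> S" for a s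
    using A that by (simp add: right_act_def)
  have hom: "g (act a s) = act' (g a) s" if "a \<in> A" "s \<in> S" for a s
    using g that by (simp add: act_hom_def)
  have comm: "g' (act a s) = act'' (g' a) s" if "a \<in> A" "s \<in> S" for a s
    using that by (simp add: g'_def act''_def hom r)
  have "right_act S mul (g' ` A) act''"
    unfolding right_act_def
  proof (intro conjI ballI)
    show "g' ` A \<noteq> {}" using A by (simp add: right_act_def)
  next
    fix x s assume "x \<in> g' ` A" and s: "s \<in> S"
    then obtain a where a: "a \<in> A" "x = g' a" by blast
    then show "act'' x s \<in> g' ` A"
      using comm[OF a(1) s] cl[OF a(1) s] by (metis imageI)
  next
    fix x s t assume "x \<in> g' ` A" and s: "s \<in> S" and t: "t \<in> S"
    then obtain a where a: "a \<in> A" "x = g' a" by blast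
    have st: "mul s t \<in> S" using S s t by (simp add: semigroup_on_def)
    have "act a (mul s t) = act (act a s) t" using A a s t by (simp add: right_act_def)
    then show "act'' x (mul s t) = act'' (act'' x s) t"
      using comm[OF a(1) st] comm[OF a(1) s] comm[OF cl[OF a(1) s] t] a(2) by simp
  qed
  moreover have "act_hom S A act (g' ` A) act'' g'"
    by (simp add: act_hom_def comm)
  moreover have "inj_on g' B"
  proof (rule inj_onI)
    fix x y assume x: "x \<in> B" and y: "y \<in> B" and eq: "g' x = g' y"
    have "x \<in> A" "y \<in> A" using large x y by (auto simp: large_subact_def subact_def)
    then have "g x = g y" using eq r(2) by (metis g'_def)
    then show "x = y" using inj x y by (simp add: inj_on_def)
  qed
  ultimately have "inj_on g' A"
    using large unfolding large_subact_def by blast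
  then show ?thesis
    by (auto simp: inj_on_def g'_def)
qed

definition uniform_act ::
  "'a set \<Rightarrow> ('a \<Rightarrow> 'a \<Rightarrow> 'a) \<Rightarrow> 'b set \<Rightarrow> ('b \<Rightarrow> 'a \<Rightarrow> 'b) \<Rightarrow> bool" where
  "uniform_act S mul A act \<longleftrightarrow>
     right_act S mul A act \<and>
     (\<forall>B. subact S B A act \<and> \<not> is_singleton B \<longrightarrow> large_subact S mul B A act)"

definition uniform_semigroup :: "'a set \<Rightarrow> ('a \<Rightarrow> 'a \<Rightarrow> 'a) \<Rightarrow> bool" where
  "uniform_semigroup S mul \<longleftrightarrow> uniform_act S mul S mul"

definition regular_semigroup :: "'a set \<Rightarrow> ('a \<Rightarrow> 'a \<Rightarrow> 'a) \<Rightarrow> bool" where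
  "regular_semigroup S mul \<longleftrightarrow>
     semigroup_on S mul \<and> (\<forall>s\<in>S. \<exists>x\<in>S. s = mul (mul s x) s)"

definition identity_of :: "'a set \<Rightarrow> ('a \<Rightarrow> 'a \<Rightarrow> 'a) \<Rightarrow> 'a \<Rightarrow> bool" where
  "identity_of S mul e \<longleftrightarrow> e \<in> S \<and> (\<forall>s\<in>S. mul e s = s \<and> mul s e = s)"

definition left_zero_of :: "'a set \<Rightarrow> ('a \<Rightarrow> 'a \<Rightarrow> 'a) \<Rightarrow> 'a \<Rightarrow> bool" where
  "left_zero_of S mul z \<longleftrightarrow> z \<in> S \<and> (\<forall>s\<in>S. mul z s = z)"

definition zero_of :: "'a set \<Rightarrow> ('a \<Rightarrow> 'a \<Rightarrow> 'a) \<Rightarrow> 'a \<Rightarrow> bool" where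
  "zero_of S mul z \<longleftrightarrow> z \<in> S \<and> (\<forall>s\<in>S. mul z s = z \<and> mul s z = z)"

definition group_with_identity :: "'a set \<Rightarrow> ('a \<Rightarrow> 'a \<Rightarrow> 'a) \<Rightarrow> 'a \<Rightarrow> bool" where
  "group_with_identity G mul e \<longleftrightarrow> group \<lparr>carrier = G, mult = mul, one = e\<rparr>"

definition right_simple :: "'a set \<Rightarrow> ('a \<Rightarrow> 'a \<Rightarrow> 'a) \<Rightarrow> bool" where
  "right_simple G mul \<longleftrightarrow> (\<forall>I. subact G I G mul \<longrightarrow> I = G)"

definition right_group :: "'a set \<Rightarrow> ('a \<Rightarrow> 'a \<Rightarrow> 'a) \<Rightarrow> bool" where
  "right_group G mul \<longleftrightarrow>
     semigroup_on G mul \<and> right_simple G mul \<and>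
     (\<forall>a\<in>G. \<forall>b\<in>G. \<forall>c\<in>G. mul a b = mul a c \<longrightarrow> b = c)"

text \<open>\<open>S = G\<^sup>0\<close>, internally: \<open>S\<close> is \<open>G\<close> together with one further element, which is a zero of \<open>S\<close>.\<close>

definition zero_adjoined :: "'a set \<Rightarrow> 'a set \<Rightarrow> ('a \<Rightarrow> 'a \<Rightarrow> 'a) \<Rightarrow> bool" where
  "zero_adjoined S G mul \<longleftrightarrow> (\<exists>z. z \<notin> G \<and> S = insert z G \<and> zero_of S mul z)"

definition group_or_group_zero :: "'a set \<Rightarrow> ('a \<Rightarrow> 'a \<Rightarrow> 'a) \<Rightarrow> bool" where
  "group_or_group_zero S mul \<longleftrightarrow>
     (\<exists>G e. group_with_identity G mul e \<and> (S = G \<or> zero_adjoined S G mul))"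

definition group_with_two_left_zeros :: "'a set \<Rightarrow> ('a \<Rightarrow> 'a \<Rightarrow> 'a) \<Rightarrow> bool" where
  "group_with_two_left_zeros S mul \<longleftrightarrow>
     (\<exists>G e \<theta>1 \<theta>2.
        S = G \<union> {\<theta>1, \<theta>2} \<and> G \<inter> {\<theta>1, \<theta>2} = {} \<and> \<theta>1 \<noteq> \<theta>2 \<and>
        group_with_identity G mul e \<and> identity_of S mul e \<and>
        left_zero_of S mul \<theta>1 \<and> left_zero_of S mul \<theta>2 \<and>
        (\<forall>g\<in>G - {e}. mul g \<theta>1 = \<theta>2 \<and> mul g \<theta>2 = \<theta>1))"

definition two_left_zeros :: "'a set \<Rightarrow> ('a \<Rightarrow> 'a \<Rightarrow> 'a) \<Rightarrow> bool" where
  "two_left_zeros S mul \<longleftrightarrow>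
     (\<exists>\<theta>1 \<theta>2. S = {\<theta>1, \<theta>2} \<and> \<theta>1 \<noteq> \<theta>2 \<and> left_zero_of S mul \<theta>1 \<and> left_zero_of S mul \<theta>2)"

definition right_group_or_right_group_zero :: "'a set \<Rightarrow> ('a \<Rightarrow> 'a \<Rightarrow> 'a) \<Rightarrow> bool" where
  "right_group_or_right_group_zero S mul \<longleftrightarrow>
     (\<exists>G. right_group G mul \<and> (S = G \<or> zero_adjoined S G mul))"

end

theory Submission
  imports Defs
begin

text \<open>
  Left multiplication by an idempotent \<open>e\<close> is a homomorphism of \<open>S\<close> into itself that is the identity
  on \<open>eS\<close>. If \<open>S\<close> is uniform, then either \<open>eS\<close> is a singleton and \<open>e\<close> is a left zero, or this
  homomorphism is injective and \<open>e\<close> is a left identity. By regularity every \<open>s\<close> that is not a left zero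
  then satisfies \<open>sS = S\<close> and is left cancellable. Three left zeros are impossible, because the right
  congruence identifying two of them is trivial on another pair. If there are exactly two, the set \<open>Z\<close>
  they form is large, so \<open>S\<close> acts faithfully on \<open>Z\<close> from the left, and the elements that are not left
  zeros are permutations of \<open>Z\<close>.
\<close>

section \<open>Criteria for the uniformity of a semigroup acting on itself\<close>

lemma right_act_self:
  assumes "semigroup_on S mul"
  shows "right_act S mul S mul"
  using assms unfolding semigroup_on_def right_act_def by metis

text \<open>A map whose kernel is a right congruence becomes a homomorphism once its image carries
  the induced action. Largeness can thus be tested on right congruences, with the values of
  \<open>k\<close> in any type.\<close>

lemma uniform_semigroup_inj_on:
  assumes S: "semigroup_on S mul"
    and unif: "uniform_semigroup S mul"
    and B: "subact S B S mul" "\<not> is_singleton B"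
    and cong: "\<And>x y s. x \<in> S \<Longrightarrow> y \<in> S \<Longrightarrow> s \<in> S \<Longrightarrow> k x = k y \<Longrightarrow> k (mul x s) = k (mul y s)"
    and inj: "inj_on k B"
  shows "inj_on k S"
proof -
  interpret semigroup_on S mul by (fact S)
  \<comment> \<open>The action is computed on a chosen preimage; \<open>cong\<close> makes the
    result independent of the choice.\<close>
  define act' where "act' c s = k (mul (inv_into S k c) s)" for c s
  have hom: "k (mul x s) = act' (k x) s" if "x \<in> S" "s \<in> S" for x s
    unfolding act'_def using that
    by (intro cong) (auto simp: inv_into_into f_inv_into_f)
  have "right_act S mul (k ` S) act'"
    unfolding right_act_def
    by (auto simp: nonempty mult_closed hom[symmetric] mult_assoc)
  moreover have "act_hom S S mul (k ` S) act' k"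
    by (simp add: act_hom_def hom)
  moreover have "large_subact S mul B S mul"
    using unif B by (simp add: uniform_semigroup_def uniform_act_def)
  ultimately show ?thesis
    using large_subact_any_codomain[OF right_act_self[OF S] _ S] inj by blast
qed

lemma uniform_semigroupI_no_proper_subact:
  assumes S: "semigroup_on S mul"
    and "\<And>B. subact S B S mul \<Longrightarrow> \<not> is_singleton B \<Longrightarrow> B = S"
  shows "uniform_semigroup S mul"
  using assms(2) right_act_self[OF S]
  unfolding uniform_semigroup_def uniform_act_def large_subact_def by blast

section \<open>Groups and right groups, possibly with a zero adjoined\<close>

lemma right_group_right_div:
  assumes "right_group G mul" "a \<in> G" "b \<in> G"
  obtains x where "x \<in> G" "mul a x = b"
proof -
  interpret semigroup_on G mul using assms(1) by (simp add: right_group_def)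
  have "subact G (mul a ` G) G mul"
    using assms(2) by (auto simp: subact_def nonempty mult_closed mult_assoc)
  then have "mul a ` G = G"
    using assms(1) by (simp add: right_group_def right_simple_def)
  then obtain x where "x \<in> G" "b = mul a x" using assms(3) by (metis imageE)
  then show ?thesis using that by blast
qed

text \<open>A right ideal that is not a singleton meets \<open>G\<close>, since at most the zero
  lies outside. With \<open>b\<close> in \<open>G\<close> it contains \<open>bS\<close>, which is
  all of \<open>S\<close>: division reaches \<open>G\<close>, and \<open>b\<close> times the zero is
  the zero.\<close>

lemma uniform_if_right_group_or_right_group_zero:
  assumes S: "semigroup_on S mul" and rg: "right_group_or_right_group_zero S mul"
  shows "uniform_semigroup S mul"
proof (rule uniform_semigroupI_no_proper_subact[OF S])
  fix B assume B: "subact S B S mul" and ns: "\<not> is_singleton B"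
  obtain G where G: "right_group G mul" and SG: "S = G \<or> zero_adjoined S G mul"
    using rg by (auto simp: right_group_or_right_group_zero_def)
  have "\<exists>b\<in>B. b \<in> G"
  proof (rule ccontr)
    assume "\<not> (\<exists>b\<in>B. b \<in> G)"
    then obtain z where "B \<subseteq> {z}"
      using B SG by (auto simp: subact_def zero_adjoined_def)
    then have "B = {z}" using B by (auto simp: subact_def)
    then show False using ns by simp
  qed
  then obtain b where b: "b \<in> B" "b \<in> G" by blast
  have closed: "mul b s \<in> B" if "s \<in> S" for s
    using B b(1) that by (simp add: subact_def)
  have "\<exists>s\<in>S. mul b s = y" if y: "y \<in> S" for y
  proof (cases "y \<in> G")
    case True
    then show ?thesis using right_group_right_div[OF G b(2)] SG
      by (metis insertCI zero_adjoined_def)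
  next
    case False
    then show ?thesis using SG y b(2)
      by (metis insert_iff zero_adjoined_def zero_of_def)
  qed
  then show "B = S" using closed B by (fastforce simp: subact_def)
qed

lemma right_group_if_group_with_identity:
  assumes "group_with_identity G mul e"
  shows "right_group G mul"
proof -
  interpret group "\<lparr>carrier = G, mult = mul, one = e\<rparr>"
    using assms by (simp add: group_with_identity_def)
  have S: "semigroup_on G mul"
    using m_closed m_assoc one_closed by unfold_locales auto
  have "I = G" if I: "subact G I G mul" for I
  proof -
    obtain i where i: "i \<in> I" "i \<in> G" using I by (auto simp: subact_def)
    have "y \<in> I" if y: "y \<in> G" for y
    proof -
      obtain j where "j \<in> G" "mul i j = e" using r_inv_ex[of i] i by auto
      then have "mul i (mul j y) = y" "mul j y \<in> G"
        using y i(2) l_one[of y] m_assoc[of i j y] m_closed[of j y] by auto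
      then show ?thesis using I i(1) by (metis subact_def)
    qed
    then show ?thesis using I by (auto simp: subact_def)
  qed
  then show ?thesis
    using S Units_l_cancel[unfolded Units_eq] by (auto simp: right_group_def right_simple_def)
qed

lemma right_group_or_right_group_zero_if_group_or_group_zero:
  "group_or_group_zero S mul \<Longrightarrow> right_group_or_right_group_zero S mul"
  unfolding group_or_group_zero_def right_group_or_right_group_zero_def
  by (metis right_group_if_group_with_identity)

lemma group_with_identityI_right_inverse:
  assumes "semigroup_on G mul" "identity_of G mul e"
    and r_inv: "\<And>a. a \<in> G \<Longrightarrow> \<exists>b\<in>G. mul a b = e"
  shows "group_with_identity G mul e"
proof -
  interpret semigroup_on G mul by (fact assms(1))
  have e: "e \<in> G" "\<And>a. a \<in> G \<Longrightarrow> mul e a = a" "\<And>a. a \<in> G \<Longrightarrow> mul a e = a"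
    using assms(2) by (auto simp: identity_of_def)
  have "\<exists>b\<in>G. mul b a = e" if a: "a \<in> G" for a
  proof -
    obtain b where b: "b \<in> G" "mul a b = e" using r_inv a by blast
    obtain c where c: "c \<in> G" "mul b c = e" using r_inv b by blast
    \<comment> \<open>Here \<open>a = a(bc) = (ab)c = c\<close>, so the right inverse
      \<open>b\<close> is also a left inverse.\<close>
    have "a = c" using a b c e mult_assoc by metis
    then show ?thesis using b c by blast
  qed
  then show ?thesis
    unfolding group_with_identity_def
    by (intro groupI) (auto simp: e mult_closed mult_assoc)
qed

text \<open>The identity cannot be an adjoined zero, because it fixes the elements of
  \<open>G\<close>. So it lies in \<open>G\<close>, where division yields right inverses.\<close>

lemma right_group_or_right_group_zero_with_identity:
  assumes rg: "right_group_or_right_group_zero S mul" and e: "identity_of S mul e"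
  shows "group_or_group_zero S mul"
proof -
  obtain G where G: "right_group G mul" and SG: "S = G \<or> zero_adjoined S G mul"
    using rg by (auto simp: right_group_or_right_group_zero_def)
  interpret semigroup_on G mul using G by (simp add: right_group_def)
  obtain g where g: "g \<in> G" using nonempty by blast
  have "e \<in> G"
    using SG e g unfolding zero_adjoined_def identity_of_def zero_of_def
    by (metis insert_iff)
  moreover have "G \<subseteq> S" using SG by (auto simp: zero_adjoined_def)
  ultimately have "identity_of G mul e" using e by (auto simp: identity_of_def)
  moreover have "\<exists>b\<in>G. mul a b = e" if "a \<in> G" for a
    using right_group_right_div[OF G that \<open>e \<in> G\<close>] by blast
  ultimately have "group_with_identity G mul e"
    by (rule group_with_identityI_right_inverse[OF semigroup_on_axioms])
  then show ?thesis using SG by (auto simp: group_or_group_zero_def)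
qed

lemma group_or_group_zero_has_identity:
  assumes "group_or_group_zero S mul"
  shows "\<exists>e. identity_of S mul e"
proof -
  obtain G e where G: "group_with_identity G mul e" and SG: "S = G \<or> zero_adjoined S G mul"
    using assms by (auto simp: group_or_group_zero_def)
  interpret group "\<lparr>carrier = G, mult = mul, one = e\<rparr>"
    using G by (simp add: group_with_identity_def)
  have "identity_of G mul e" using one_closed l_one r_one by (auto simp: identity_of_def)
  then have "identity_of S mul e"
    using SG by (auto simp: identity_of_def zero_adjoined_def zero_of_def)
  then show ?thesis ..
qed

section \<open>Semigroups with exactly two left zeros\<close>

lemma two_left_zeros_no_identity:
  "two_left_zeros S mul \<Longrightarrow> \<not> identity_of S mul e"
  by (force simp: two_left_zeros_def identity_of_def left_zero_of_def)

lemma uniform_if_two_left_zeros: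
  assumes S: "semigroup_on S mul" and "two_left_zeros S mul"
  shows "uniform_semigroup S mul"
proof (rule uniform_semigroupI_no_proper_subact[OF S])
  fix B assume "subact S B S mul" "\<not> is_singleton B"
  moreover obtain a b where "S = {a, b}" using assms(2) by (auto simp: two_left_zeros_def)
  ultimately show "B = S"
    unfolding subact_def is_singleton_def by blast
qed

text \<open>Every right ideal that is not a singleton contains both left zeros, and left
  multiplication on these two elements is faithful. A homomorphism injective on the left zeros
  therefore separates all elements of \<open>S\<close>.\<close>

lemma uniform_if_group_with_two_left_zeros:
  assumes S: "semigroup_on S mul" and "group_with_two_left_zeros S mul"
  shows "uniform_semigroup S mul"
proof -
  interpret semigroup_on S mul by (fact S)
  obtain G e t1 t2 where
    SG: "S = G \<union> {t1, t2}" "G \<inter> {t1, t2} = {}" "t1 \<noteq> t2" and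
    G: "group_with_identity G mul e" and e: "identity_of S mul e" and
    lz: "left_zero_of S mul t1" "left_zero_of S mul t2" and
    swap: "\<And>g. g \<in> G \<Longrightarrow> g \<noteq> e \<Longrightarrow> mul g t1 = t2 \<and> mul g t2 = t1"
    using assms(2) unfolding group_with_two_left_zeros_def by (elim exE conjE) auto
  interpret G: group "\<lparr>carrier = G, mult = mul, one = e\<rparr>"
    using G by (simp add: group_with_identity_def)
  have idS: "mul e s = s" "mul s e = s" if "s \<in> S" for s
    using e that by (auto simp: identity_of_def)
  have z: "mul t1 s = t1" "mul t2 s = t2" if "s \<in> S" for s
    using lz that by (auto simp: left_zero_of_def)
  have tS: "t1 \<in> S" "t2 \<in> S" using SG by auto
  \<comment> \<open>Swapping twice fixes \<open>t1\<close>, whereas an element of \<open>G\<close>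
    other than \<open>e\<close> moves it.\<close>
  have sq: "mul g g = e" if g: "g \<in> G" for g
  proof (rule ccontr)
    assume ne: "mul g g \<noteq> e"
    then have "g \<noteq> e" using idS g SG(1) by auto
    have "mul g g \<in> G" using G.m_closed[of g g] g by simp
    then have "mul (mul g g) t1 = t2" using swap ne by blast
    moreover have "mul (mul g g) t1 = t1"
      using swap[OF g \<open>g \<noteq> e\<close>] mult_assoc[of g g t1] g tS SG(1) by auto
    ultimately show False using SG(3) by simp
  qed
  \<comment> \<open>If neither element is \<open>e\<close>, both swap, so \<open>ab\<close> fixes
    \<open>t1\<close> and \<open>ab = e = aa\<close>; cancelling \<open>a\<close> gives
    \<open>a = b\<close>. In effect \<open>G\<close> has at most two elements.\<close>
  have faithful: "a = b" if "a \<in> G" "b \<in> G" "mul a t1 = mul b t1" for a b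
  proof -
    have "a = e \<longleftrightarrow> b = e"
      using that swap idS tS SG(3) by metis
    moreover have "a = b" if "a \<noteq> e" "b \<noteq> e"
    proof -
      have mG: "mul a b \<in> G" using G.m_closed[of a b] \<open>a \<in> G\<close> \<open>b \<in> G\<close> by simp
      have "mul (mul a b) t1 = t1"
        using swap[of a] swap[of b] that \<open>a \<in> G\<close> \<open>b \<in> G\<close> mult_assoc[of a b t1] tS SG(1) by auto
      then have "mul a b = e" using swap[OF mG] SG(3) by metis
      then have "mul a b = mul a a" using sq \<open>a \<in> G\<close> by simp
      then show ?thesis using G.Units_l_cancel[unfolded G.Units_eq, of a b a] \<open>a \<in> G\<close> \<open>b \<in> G\<close> by simp
    qed
    ultimately show ?thesis by blast
  qed
  have perm: "(mul a t1 = t1 \<and> mul a t2 = t2) \<or> (mul a t1 = t2 \<and> mul a t2 = t1)"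
    if "a \<in> G" for a
    using that swap idS tS by (cases "a = e") auto
  have "large_subact S mul B S mul"
    if B: "subact S B S mul" and ns: "\<not> is_singleton B" for B
  proof -
    have inB: "mul b s \<in> B" if "b \<in> B" "s \<in> S" for b s
      using B that by (simp add: subact_def)
    have tB: "t1 \<in> B \<and> t2 \<in> B"
    proof (cases "\<exists>b\<in>B. b \<in> G")
      case True
      then obtain b where b: "b \<in> B" "b \<in> G" by blast
      show ?thesis using perm[OF b(2)] inB[OF b(1) tS(1)] inB[OF b(1) tS(2)] by auto
    next
      case False
      then have "B \<subseteq> {t1, t2}" using B SG(1) by (auto simp: subact_def)
      moreover have "B \<noteq> {t1}" "B \<noteq> {t2}" "B \<noteq> {}"
        using ns B by (auto simp: subact_def)
      ultimately show ?thesis by blast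
    qed
    have "inj_on g S"
      if hom: "act_hom S S mul C act' g" and inj: "inj_on g B" for C act' and g :: "'a \<Rightarrow> 'a"
    proof (rule inj_onI)
      fix x y assume x: "x \<in> S" and y: "y \<in> S" and eq: "g x = g y"
      have gm: "g (mul x s) = g (mul y s)" if "s \<in> S" for s
        using hom x y eq that by (simp add: act_hom_def)
      have mT: "mul w t \<in> {t1, t2}" if "w \<in> S" "t \<in> {t1, t2}" for w t
        using that SG(1) perm[of w] z tS by auto
      \<comment> \<open>Both products lie in \<open>{t1, t2}\<close>, hence in \<open>B\<close>,
        where the homomorphism \<open>g\<close> is injective.\<close>
      have same: "mul x t = mul y t" if "t \<in> {t1, t2}" for t
      proof (rule inj_onD[OF inj])
        show "g (mul x t) = g (mul y t)" using gm that tS by blast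
        show "mul x t \<in> B" "mul y t \<in> B" using mT[OF x that] mT[OF y that] tB by auto
      qed
      have G_ne: "mul w t1 \<noteq> mul w t2" if "w \<in> G" for w
        using perm[OF that] SG(3) by metis
      have not_G: "mul w t1 = w" "mul w t2 = w" if "w \<in> S" "w \<notin> G" for w
        using that SG(1) z tS by auto
      have same12: "mul x t1 = mul y t1" "mul x t2 = mul y t2" using same by auto
      \<comment> \<open>An element of \<open>G\<close> keeps \<open>t1\<close> and \<open>t2\<close>
        apart, while a left zero sends both to itself.\<close>
      have "x \<in> G \<longleftrightarrow> y \<in> G"
        using G_ne not_G same12 x y by metis
      then show "x = y"
        using faithful not_G same12 x y by metis
    qed
    then show ?thesis using B unfolding large_subact_def by blast
  qed
  then show ?thesis
    using right_act_self[OF S] by (simp add: uniform_semigroup_def uniform_act_def)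
qed

section \<open>Structure of a regular uniform semigroup\<close>

locale regular_uniform_semigroup = semigroup_on +
  assumes regular: "s \<in> S \<Longrightarrow> \<exists>x\<in>S. s = mul (mul s x) s"
    and uniform: "uniform_semigroup S mul"
begin

lemma idempotent_left_zero_or_left_identity:
  assumes e: "e \<in> S" "mul e e = e"
  shows "left_zero_of S mul e \<or> (\<forall>s\<in>S. mul e s = s)"
proof (cases "is_singleton (mul e ` S)")
  case True
  then obtain c where c: "mul e ` S = {c}" by (auto simp: is_singleton_def)
  then have "mul e s = c" if "s \<in> S" for s using that by blast
  \<comment> \<open>The constant value is \<open>ee = e\<close>.\<close>
  then show ?thesis using e by (auto simp: left_zero_of_def)
next
  case False
  have "subact S (mul e ` S) S mul"
    using e(1) by (auto simp: subact_def nonempty mult_closed mult_assoc)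
  moreover have idem: "mul e (mul e s) = mul e s" if "s \<in> S" for s
    using e that mult_assoc by metis
  then have "inj_on (mul e) (mul e ` S)" by (auto intro!: inj_onI)
  moreover have "mul e (mul x s) = mul e (mul y s)"
    if "x \<in> S" "y \<in> S" "s \<in> S" "mul e x = mul e y" for x y s
    using that e(1) mult_assoc by metis
  ultimately have "inj_on (mul e) S"
    using uniform_semigroup_inj_on[OF semigroup_on_axioms uniform _ False, of "mul e"] by blast
  \<comment> \<open>Injectivity cancels the outer \<open>e\<close> in
    \<open>e(es) = es\<close>.\<close>
  then show ?thesis using idem e(1) by (meson inj_onD mult_closed)
qed

text \<open>For \<open>s = sxs\<close> both \<open>sx\<close> and \<open>xs\<close> are idempotent.
  If \<open>sx\<close> is a left zero, then \<open>s = (sx)s = sx\<close>; if \<open>xs\<close> is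
  one, then \<open>st = s(xs)t = s(xs) = s\<close>. Either would make \<open>s\<close> a left zero,
  so both idempotents are left identities.\<close>

lemma not_left_zero_inverse:
  assumes s: "s \<in> S" "\<not> left_zero_of S mul s"
  shows "\<exists>x\<in>S. \<forall>t\<in>S. mul (mul s x) t = t \<and> mul (mul x s) t = t"
proof -
  obtain x where x: "x \<in> S" "s = mul (mul s x) s" using regular s by blast
  have sx: "mul s x \<in> S" and xs: "mul x s \<in> S" using s x mult_closed by auto
  have "mul (mul s x) (mul s x) = mul s x"
    using x s sx mult_assoc by metis
  moreover have "\<not> left_zero_of S mul (mul s x)"
    using s x by (metis left_zero_of_def)
  ultimately have 1: "mul (mul s x) t = t" if "t \<in> S" for t
    using idempotent_left_zero_or_left_identity[OF sx] that by blast
  have idem: "mul (mul x s) (mul x s) = mul x s"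
    using x s xs mult_assoc by metis
  have "\<not> left_zero_of S mul (mul x s)"
  proof
    assume lz: "left_zero_of S mul (mul x s)"
    have sxs: "mul s (mul x s) = s" using x s mult_assoc by metis
    have "mul s t = s" if "t \<in> S" for t
    proof -
      have "mul s t = mul (mul s (mul x s)) t" using sxs by simp
      also have "\<dots> = mul s (mul (mul x s) t)" using mult_assoc s xs that by blast
      also have "\<dots> = s" using lz that sxs by (simp add: left_zero_of_def)
      finally show ?thesis .
    qed
    then show False using s by (simp add: left_zero_of_def)
  qed
  then have 2: "mul (mul x s) t = t" if "t \<in> S" for t
    using idempotent_left_zero_or_left_identity[OF xs idem] that by blast
  show ?thesis using x(1) 1 2 by blast
qed

lemma not_left_zero_cancel:
  assumes "s \<in> S" "\<not> left_zero_of S mul s" "a \<in> S" "b \<in> S" "mul s a = mul s b"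
  shows "a = b"
  using not_left_zero_inverse[OF assms(1,2)] assms mult_assoc by metis

text \<open>If \<open>st\<close> is a left zero, then \<open>s(tu) = st\<close>, and cancelling
  \<open>s\<close> makes \<open>t\<close> a left zero.\<close>

lemma not_left_zero_mult:
  assumes "s \<in> S" "\<not> left_zero_of S mul s" "t \<in> S" "\<not> left_zero_of S mul t"
  shows "\<not> left_zero_of S mul (mul s t)"
proof
  assume lz: "left_zero_of S mul (mul s t)"
  have "mul t u = t" if u: "u \<in> S" for u
  proof (rule not_left_zero_cancel[OF assms(1,2)])
    show "mul s (mul t u) = mul s t"
      using lz u assms mult_assoc by (metis left_zero_of_def)
  qed (use u assms mult_closed in auto)
  then show False using assms by (simp add: left_zero_of_def)
qed

lemma mult_left_zero:
  assumes "s \<in> S" "left_zero_of S mul z"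
  shows "left_zero_of S mul (mul s z)"
  using assms by (simp add: left_zero_of_def mult_closed mult_assoc)

lemma at_most_two_left_zeros:
  assumes "left_zero_of S mul a" "left_zero_of S mul b" "left_zero_of S mul c"
  shows "a = b \<or> a = c \<or> b = c"
proof (rule ccontr)
  assume d: "\<not> ?thesis"
  \<comment> \<open>The kernel of \<open>k\<close> identifies only \<open>a\<close> and
    \<open>c\<close>. It is a right congruence because right multiplication fixes both.\<close>
  define k where "k x = (if x = c then a else x)" for x
  have "inj_on k S"
  proof (rule uniform_semigroup_inj_on[OF semigroup_on_axioms uniform])
    show "subact S {a, b} S mul" using assms by (auto simp: subact_def left_zero_of_def)
    show "\<not> is_singleton {a, b}" using d by (auto simp: is_singleton_def)
    show "inj_on k {a, b}" using d by (auto simp: k_def)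
  next
    fix x y s assume "x \<in> S" "y \<in> S" "s \<in> S" "k x = k y"
    then show "k (mul x s) = k (mul y s)"
      using assms by (auto simp: k_def left_zero_of_def split: if_splits)
  qed
  moreover have "k a = k c" "a \<in> S" "c \<in> S"
    using assms by (auto simp: k_def left_zero_of_def)
  ultimately have "a = c" by (rule inj_onD)
  then show False using d by simp
qed

lemma right_group_if_complement_of_left_zeros:
  assumes G: "G = {s \<in> S. \<not> left_zero_of S mul s}" "G \<noteq> {}"
  shows "right_group G mul"
proof -
  have closed: "mul s t \<in> G" if "s \<in> G" "t \<in> G" for s t
    using that not_left_zero_mult mult_closed by (auto simp: G(1))
  then have "semigroup_on G mul"
    using G mult_assoc by unfold_locales auto
  moreover have "I = G" if I: "subact G I G mul" for I
  proof -
    obtain i where i: "i \<in> I" "i \<in> G" using I by (auto simp: subact_def)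
    have iS: "i \<in> S" "\<not> left_zero_of S mul i" using i G by auto
    obtain x where x: "x \<in> S" "\<And>t. t \<in> S \<Longrightarrow> mul (mul i x) t = t"
      using not_left_zero_inverse[OF iS] by auto
    have "y \<in> I" if y: "y \<in> G" for y
    proof -
      have yS: "y \<in> S" "\<not> left_zero_of S mul y" using y G by auto
      have iy: "mul i (mul x y) = y" using x yS(1) iS(1) mult_assoc by metis
      \<comment> \<open>Were \<open>xy\<close> a left zero, \<open>y = i(xy)\<close> would be one
        too.\<close>
      then have "mul x y \<in> G"
        using mult_left_zero[OF iS(1), of "mul x y"] mult_closed[OF x(1) yS(1)] yS(2)
        by (auto simp: G(1))
      then show ?thesis using I i(1) iy by (metis subact_def)
    qed
    then show ?thesis using I by (auto simp: subact_def)
  qed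
  moreover have "b = c" if "a \<in> G" "b \<in> G" "c \<in> G" "mul a b = mul a c" for a b c
    using that not_left_zero_cancel by (auto simp: G(1))
  ultimately show ?thesis by (auto simp: right_group_def right_simple_def)
qed

lemma group_with_two_left_zeros_or_two_left_zeros:
  assumes lz: "left_zero_of S mul t1" "left_zero_of S mul t2" and ne: "t1 \<noteq> t2"
  shows "group_with_two_left_zeros S mul \<or> two_left_zeros S mul"
proof (cases "S = {t1, t2}")
  case True
  then show ?thesis using lz ne by (auto simp: two_left_zeros_def)
next
  case False
  have tS: "t1 \<in> S" "t2 \<in> S" using lz by (auto simp: left_zero_of_def)
  have z: "mul t1 s = t1" "mul t2 s = t2" if "s \<in> S" for s
    using lz that by (auto simp: left_zero_of_def)
  have lz_iff: "left_zero_of S mul s \<longleftrightarrow> s = t1 \<or> s = t2" for s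
    using at_most_two_left_zeros[OF lz] lz ne by blast
  \<comment> \<open>\<open>k\<close> records the left action on the two left zeros. It is injective
    on them, as each gives a constant pair.\<close>
  define k where "k x = (mul x t1, mul x t2)" for x
  have mT: "mul s t = t1 \<or> mul s t = t2" if "s \<in> S" "t = t1 \<or> t = t2" for s t
    using mult_left_zero[OF that(1)] that(2) lz_iff by blast
  have "inj_on k S"
  proof (rule uniform_semigroup_inj_on[OF semigroup_on_axioms uniform])
    show "subact S {t1, t2} S mul" using z tS by (auto simp: subact_def)
    show "\<not> is_singleton {t1, t2}" using ne by (auto simp: is_singleton_def)
    show "inj_on k {t1, t2}" using ne z tS by (auto simp: k_def)
  next
    fix x y s assume h: "x \<in> S" "y \<in> S" "s \<in> S" "k x = k y"
    \<comment> \<open>The product \<open>st\<close> is again \<open>t1\<close> or \<open>t2\<close>,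
      so \<open>k\<close> already determines its images.\<close>
    then have "mul x (mul s t) = mul y (mul s t)" if "t = t1 \<or> t = t2" for t
      using mT[OF h(3) that] by (auto simp: k_def)
    then show "k (mul x s) = k (mul y s)"
      using h tS by (auto simp: k_def mult_assoc)
  qed
  then have faithful: "x = y" if "x \<in> S" "y \<in> S" "mul x t1 = mul y t1" "mul x t2 = mul y t2" for x y
    using that by (simp add: inj_on_def k_def)
  define G where "G = S - {t1, t2}"
  have G: "g \<in> S" "\<not> left_zero_of S mul g" if "g \<in> G" for g
    using that lz_iff by (auto simp: G_def)
  \<comment> \<open>Elements of \<open>G\<close> are left cancellable, so they act injectively on
    the two left zeros.\<close>
  have perm: "(mul g t1 = t1 \<and> mul g t2 = t2) \<or> (mul g t1 = t2 \<and> mul g t2 = t1)"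
    if "g \<in> G" for g
    using mT[OF G(1)[OF that]] not_left_zero_cancel[OF G[OF that] tS] ne by metis
  have "G \<noteq> {}" using False tS by (auto simp: G_def)
  then obtain g where g: "g \<in> G" by blast
  obtain x where x: "x \<in> S" "\<And>t. t \<in> S \<Longrightarrow> mul (mul g x) t = t"
    using not_left_zero_inverse[OF G[OF g]] by auto
  define e where "e = mul g x"
  have eS: "e \<in> S" unfolding e_def using G g x mult_closed by blast
  have e: "identity_of S mul e"
  proof -
    have l: "mul e t = t" if "t \<in> S" for t using x that by (simp add: e_def)
    \<comment> \<open>Since \<open>e\<close> fixes \<open>t1\<close> and \<open>t2\<close>,
      \<open>se\<close> and \<open>s\<close> act on them alike.\<close>
    have "mul s e = s" if s: "s \<in> S" for s
      by (rule faithful) (use s eS tS l mult_assoc mult_closed in auto)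
    then show ?thesis using eS l by (simp add: identity_of_def)
  qed
  have eG: "e \<in> G" using eS e z tS ne by (auto simp: G_def identity_of_def)
  have id_e: "mul e s = s" if "s \<in> S" for s using e that by (simp add: identity_of_def)
  have swap: "mul h t1 = t2 \<and> mul h t2 = t1" if h: "h \<in> G" "h \<noteq> e" for h
    using perm[OF h(1)] faithful[OF G(1)[OF h(1)] eS] id_e tS h(2) by metis
  have closed: "mul a b \<in> G" if "a \<in> G" "b \<in> G" for a b
    using not_left_zero_mult[OF G[OF that(1)] G[OF that(2)]]
      mult_closed[OF G(1)[OF that(1)] G(1)[OF that(2)]]
    by (simp add: G_def lz_iff)
  have "semigroup_on G mul"
    using \<open>G \<noteq> {}\<close> closed mult_assoc G(1) by unfold_locales auto
  moreover have "identity_of G mul e"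
    using e eG G(1) by (auto simp: identity_of_def)
  moreover have "\<exists>b\<in>G. mul a b = e" if a: "a \<in> G" for a
  proof
    \<comment> \<open>The square of any permutation of two points is trivial, so \<open>aa\<close>
      acts as \<open>e\<close> does.\<close>
    show "mul a a = e"
      by (rule faithful) (use perm[OF a] mult_assoc mult_closed G(1)[OF a] eS id_e tS in auto)
  qed (fact a)
  ultimately have "group_with_identity G mul e"
    by (rule group_with_identityI_right_inverse)
  moreover have "S = G \<union> {t1, t2}" "G \<inter> {t1, t2} = {}" using tS by (auto simp: G_def)
  ultimately have "group_with_two_left_zeros S mul"
    unfolding group_with_two_left_zeros_def using ne e lz swap by blast
  then show ?thesis ..
qed

text \<open>A sole left zero \<open>z\<close> is a zero, because every \<open>sz\<close> is again a
  left zero. The remaining elements form a right group, nonempty because \<open>S\<close> has at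
  least two elements.\<close>

lemma structure_cases:
  assumes nontrivial: "\<exists>x\<in>S. \<exists>y\<in>S. x \<noteq> y"
  shows "group_with_two_left_zeros S mul \<or> two_left_zeros S mul \<or>
    right_group_or_right_group_zero S mul"
proof (cases "\<exists>a b. left_zero_of S mul a \<and> left_zero_of S mul b \<and> a \<noteq> b")
  case True
  then show ?thesis using group_with_two_left_zeros_or_two_left_zeros by blast
next
  case unique: False
  define G where "G = {s \<in> S. \<not> left_zero_of S mul s}"
  have "G \<noteq> {}" using nontrivial unique by (auto simp: G_def)
  then have G: "right_group G mul" by (rule right_group_if_complement_of_left_zeros[OF G_def])
  have "S = G \<or> zero_adjoined S G mul"
  proof (cases "\<exists>z. left_zero_of S mul z")
    case True
    then obtain z where z: "left_zero_of S mul z" by blast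
    then have "zero_of S mul z"
      using mult_left_zero[OF _ z] unique unfolding zero_of_def
      by (metis left_zero_of_def)
    moreover have "S = insert z G" "z \<notin> G"
      using z unique by (auto simp: G_def left_zero_of_def)
    ultimately show ?thesis by (auto simp: zero_adjoined_def)
  qed (auto simp: G_def)
  then show ?thesis using G by (auto simp: right_group_or_right_group_zero_def)
qed

end

theorem theorem3p8:
  fixes S :: "'a set" and mul :: "'a \<Rightarrow> 'a \<Rightarrow> 'a"
  assumes "regular_semigroup S mul"
    and "\<exists>x\<in>S. \<exists>y\<in>S. x \<noteq> y"
  shows "(uniform_semigroup S mul \<longleftrightarrow>
            group_or_group_zero S mul \<or> group_with_two_left_zeros S mul \<or>
            two_left_zeros S mul \<or> right_group_or_right_group_zero S mul) \<and>
         ((\<exists>e. identity_of S mul e) \<longrightarrow>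
            (uniform_semigroup S mul \<longleftrightarrow>
               group_or_group_zero S mul \<or> group_with_two_left_zeros S mul)) \<and>
         ((\<nexists>e. identity_of S mul e) \<longrightarrow>
            (uniform_semigroup S mul \<longleftrightarrow>
               two_left_zeros S mul \<or> right_group_or_right_group_zero S mul))"
proof -
  have S: "semigroup_on S mul" using assms(1) by (simp add: regular_semigroup_def)
  \<comment> \<open>Groups, with or without zero, are covered by the right group case.\<close>
  have classification: "group_with_two_left_zeros S mul \<or> two_left_zeros S mul \<or>
      right_group_or_right_group_zero S mul" if "uniform_semigroup S mul"
  proof -
    interpret regular_uniform_semigroup S mul
      using assms(1) that
      by (auto simp: regular_semigroup_def regular_uniform_semigroup_def
          regular_uniform_semigroup_axioms_def)
    show ?thesis by (rule structure_cases[OF assms(2)])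
  qed
  have two_id: "\<exists>e. identity_of S mul e" if "group_with_two_left_zeros S mul"
    using that by (auto simp: group_with_two_left_zeros_def)
  \<comment> \<open>An identity excludes the two-element case and turns the right group into a
    group. Without one, the group with two left zeros is excluded, since its \<open>e\<close> is an
    identity of \<open>S\<close>.\<close>
  show ?thesis
    using classification two_id
      uniform_if_group_with_two_left_zeros[OF S] uniform_if_two_left_zeros[OF S]
      uniform_if_right_group_or_right_group_zero[OF S]
      right_group_or_right_group_zero_if_group_or_group_zero[of S mul]
      group_or_group_zero_has_identity[of S mul]
      right_group_or_right_group_zero_with_identity[of S mul]
      two_left_zeros_no_identity[of S mul]
    by blast
qed

end
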